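(* If $(G,\sigma)$ is a symmetric group (in the sense of Takeuchi), i.e. a braided group with involutive braiding operator, whose cardinality is a (finite) cube-free number, then $(G,\sigma)$ has a finite multipermutation level.
   Context: A braided group is a pair $(G,\sigma)$, where $G$ is a group and $\sigma:G\times G\to G\times G$, $\sigma(a,u)=({}^a u,\,a^u)$, is a bijective map such that for all $a,b,u,v\in G$: ${}^{1}u=u$, ${}^a1=1$, ${}^{ab}u={}^a({}^bu)$, ${}^a(uv)=({}^au)({}^{(a^u)}v)$; $a^1=a$, $1^u=1$, $a^{uv}=(a^u)^v$, $(ab)^u=(a^{({}^bu)})(b^u)$; and $au=({}^au)(a^u)$. It is called a symmetric group (in the sense of Takeuchi) if $\sigma$ is involutive, $\sigma^2=\mathrm{id}_{G\times G}$. In that case $(G,\sigma)$ is a non-degenerate involutive set-theoretic solution of the Yang-Baxter equation. For a non-degenerate involutive solution $(X,r)$, $r(x,y)=(\sigma_x(y),\tau_y(x))$, define $x\sim y$ iff $\sigma_x=\sigma_y$; then $r$ induces a solution on $X/\!\sim$, called the retraction of $(X,r)$. The solution has a finite multipermutation level if after applying retraction some finite number $m\ge 0$ of times one obtains a solution of cardinality $1$. A positive integer is cube-free if it is not divisible by the cube of any prime. *)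

theory Defs
  imports "HOL-Algebra.Coset" "HOL-Computational_Algebra.Primes"
begin

(* In the two locales below, lact a u and ract a u stand for the left action of a on u and
   the right action of u on a, i.e. the two components of \<sigma> (a, u). *)

locale braided_group = group G for G (structure) +
  fixes \<sigma> :: "'a \<times> 'a \<Rightarrow> 'a \<times> 'a"
  fixes lact ract :: "'a \<Rightarrow> 'a \<Rightarrow> 'a"
  defines "lact a u \<equiv> fst (\<sigma> (a, u))" and "ract a u \<equiv> snd (\<sigma> (a, u))"
  assumes bij_braiding: "bij_betw \<sigma> (carrier G \<times> carrier G) (carrier G \<times> carrier G)"
    and one_lact: "u \<in> carrier G \<Longrightarrow> lact \<one> u = u"
    and lact_one: "a \<in> carrier G \<Longrightarrow> lact a \<one> = \<one>"
    and mult_lact: "\<lbrakk>a \<in> carrier G; b \<in> carrier G; u \<in> carrier G\<rbrakk>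
      \<Longrightarrow> lact (a \<otimes> b) u = lact a (lact b u)"
    and lact_mult: "\<lbrakk>a \<in> carrier G; u \<in> carrier G; v \<in> carrier G\<rbrakk>
      \<Longrightarrow> lact a (u \<otimes> v) = lact a u \<otimes> lact (ract a u) v"
    and ract_one: "a \<in> carrier G \<Longrightarrow> ract a \<one> = a"
    and one_ract: "u \<in> carrier G \<Longrightarrow> ract \<one> u = \<one>"
    and ract_mult: "\<lbrakk>a \<in> carrier G; u \<in> carrier G; v \<in> carrier G\<rbrakk>
      \<Longrightarrow> ract a (u \<otimes> v) = ract (ract a u) v"
    and mult_ract: "\<lbrakk>a \<in> carrier G; b \<in> carrier G; u \<in> carrier G\<rbrakk>
      \<Longrightarrow> ract (a \<otimes> b) u = ract a (lact b u) \<otimes> ract b u"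
    and compatible: "\<lbrakk>a \<in> carrier G; u \<in> carrier G\<rbrakk>
      \<Longrightarrow> a \<otimes> u = lact a u \<otimes> ract a u"

(* "Symmetric group" in the sense of Takeuchi; unrelated to groups of permutations. *)
locale takeuchi_symmetric_group = braided_group +
  assumes involutive: "x \<in> carrier G \<times> carrier G \<Longrightarrow> \<sigma> (\<sigma> x) = x"

definition retract_rel :: "'a set \<Rightarrow> ('a \<times> 'a \<Rightarrow> 'a \<times> 'a) \<Rightarrow> ('a \<times> 'a) set" where
  "retract_rel X r =
    {(x, y). x \<in> X \<and> y \<in> X \<and> (\<forall>z\<in>X. fst (r (x, z)) = fst (r (y, z)))}"

definition retract_carrier :: "'a set \<Rightarrow> ('a \<times> 'a \<Rightarrow> 'a \<times> 'a) \<Rightarrow> 'a set set" where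
  "retract_carrier X r = X // retract_rel X r"

(* The map ([x], [y]) \<mapsto> ([fst (r (x, y))], [snd (r (x, y))]) on classes. For a
   non-degenerate involutive solution all members of each union below are equal. *)
definition retract_map ::
    "'a set \<Rightarrow> ('a \<times> 'a \<Rightarrow> 'a \<times> 'a) \<Rightarrow> 'a set \<times> 'a set \<Rightarrow> 'a set \<times> 'a set" where
  "retract_map X r = (\<lambda>(A, B).
    ((\<Union>x\<in>A. \<Union>y\<in>B. retract_rel X r `` {fst (r (x, y))}),
     (\<Union>x\<in>A. \<Union>y\<in>B. retract_rel X r `` {snd (r (x, y))})))"

definition solution_iso ::
    "'a set \<Rightarrow> ('a \<times> 'a \<Rightarrow> 'a \<times> 'a) \<Rightarrow> 'b set \<Rightarrow> ('b \<times> 'b \<Rightarrow> 'b \<times> 'b) \<Rightarrow> bool" where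
  "solution_iso X r Y s \<longleftrightarrow>
    (\<exists>f. bij_betw f X Y \<and> (\<forall>x\<in>X. \<forall>y\<in>X. s (f x, f y) = map_prod f f (r (x, y))))"

(* retracts_to_point m X r: the m-fold iterated retraction of (X, r) has cardinality 1.
   A retraction lives on the type of sets over the original type, so to iterate it inside one
   type each retraction is replaced by an isomorphic copy on the original type; such a copy
   always exists, see retraction_copy below. *)
inductive retracts_to_point :: "nat \<Rightarrow> 'a set \<Rightarrow> ('a \<times> 'a \<Rightarrow> 'a \<times> 'a) \<Rightarrow> bool" where
  point: "card X = 1 \<Longrightarrow> retracts_to_point 0 X r"
| retract: "\<lbrakk>solution_iso (retract_carrier X r) (retract_map X r) Y s; retracts_to_point m Y s\<rbrakk>
    \<Longrightarrow> retracts_to_point (Suc m) X r"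

definition finite_multipermutation_level :: "'a set \<Rightarrow> ('a \<times> 'a \<Rightarrow> 'a \<times> 'a) \<Rightarrow> bool" where
  "finite_multipermutation_level X r \<longleftrightarrow> (\<exists>m. retracts_to_point m X r)"

lemma retraction_copy:
  "\<exists>Y s. Y \<subseteq> X \<and> solution_iso (retract_carrier X r) (retract_map X r) Y s"
proof -
  define f where "f A = (SOME x. x \<in> A)" for A :: "'a set"
  define g where "g = inv_into (retract_carrier X r) f"
  define s where "s = (\<lambda>(a, b). map_prod f f (retract_map X r (g a, g b)))"
  have eq: "equiv X (retract_rel X r)"
    by (auto simp: equiv_def refl_on_def sym_def trans_def retract_rel_def)
  have f_in: "f A \<in> A" if "A \<in> retract_carrier X r" for A
    using in_quotient_imp_non_empty[OF eq] that
    unfolding f_def retract_carrier_def by (metis some_in_eq)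
  have inj: "inj_on f (retract_carrier X r)"
  proof (rule inj_onI)
    fix A B assume AB: "A \<in> retract_carrier X r" "B \<in> retract_carrier X r" "f A = f B"
    then have "f A \<in> A \<inter> B" using f_in by (metis IntI)
    then show "A = B"
      using quotient_disj[OF eq] AB unfolding retract_carrier_def by blast
  qed
  have "f ` retract_carrier X r \<subseteq> X"
    using f_in in_quotient_imp_subset[OF eq] unfolding retract_carrier_def by blast
  moreover have "solution_iso (retract_carrier X r) (retract_map X r) (f ` retract_carrier X r) s"
    unfolding solution_iso_def using inj
    by (intro exI[of _ f]) (auto simp: bij_betw_def s_def g_def)
  ultimately show ?thesis by blast
qed

definition cube_free :: "nat \<Rightarrow> bool" where
  "cube_free n \<longleftrightarrow> n > 0 \<and> (\<forall>p. prime p \<longrightarrow> \<not> p ^ 3 dvd n)"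

end

theory Submission
  imports Defs "HOL-Algebra.Group_Action" "HOL-Algebra.Sylow" "HOL-Algebra.Weak_Morphisms"
    "HOL-Algebra.Multiplicative_Group"
begin

text \<open>
  With \<open>a \<boxplus> b = a \<otimes> lact (inv a) b\<close> the group becomes a left brace: \<open>\<boxplus>\<close> is commutative and
  \<open>lact\<close> acts by automorphisms of it, so every additive Sylow subgroup \<open>A\<^sub>p\<close> is stable under the
  action and is also a multiplicative subgroup. The retraction is the quotient by the socle, the
  kernel of the action, so by induction on the order it suffices that the socle is nontrivial.

  Since \<open>A\<^sub>p\<close> has order \<open>p\<close> or \<open>p\<^sup>2\<close>, counting orbits shows that the kernel \<open>K\<^sub>p\<close> of the action of
  \<open>A\<^sub>p\<close> on itself is nontrivial. Let \<open>p\<close> be the largest prime dividing the order. Counting fixed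
  points, \<open>K\<^sub>p\<close> acts trivially on every \<open>A\<^sub>q\<close>, hence lies in the socle, unless \<open>p = 3\<close>, \<open>q = 2\<close> and
  \<open>K\<^sub>3\<close> has no nontrivial fixed point in \<open>A\<^sub>2\<close>. In that case the order has no prime factors besides
  2 and 3, and comparing the two sides of \<open>a y = (lact a y) (ract a y)\<close> on \<open>A\<^sub>2\<close> and on \<open>A\<^sub>3\<close> shows
  that \<open>K\<^sub>3\<close> fixes \<open>K\<^sub>2\<close> pointwise if the socle is trivial, a contradiction.
\<close>

section \<open>Finite groups\<close>

text \<open>The moved points are a disjoint union of orbits with more than one element. By the
  orbit-stabilizer theorem the size of each is a power of p other than 1.\<close>

lemma (in group_action) p_group_moved_points:
  assumes "prime p" and "order G = p ^ k" and "finite E"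
  shows "p dvd card {x \<in> E. \<exists>g\<in>carrier G. \<phi> g x \<noteq> x}"
proof -
  interpret group G
    using group_hom group_hom.axioms(1) by auto
  let ?M = "{x \<in> E. \<exists>g\<in>carrier G. \<phi> g x \<noteq> x}"
  let ?C = "{orbit G \<phi> x | x. x \<in> ?M}"
  have sub: "orbit G \<phi> x \<subseteq> ?M" if "x \<in> ?M" for x
  proof
    fix y assume y: "y \<in> orbit G \<phi> x"
    have yE: "y \<in> E"
      using y that element_image unfolding orbit_def by blast
    have "x \<in> orbit G \<phi> y"
      using orbit_sym that yE y by blast
    then obtain g where g: "g \<in> carrier G" "\<phi> g y = x"
      unfolding orbit_def by blast
    show "y \<in> ?M"
    proof (cases "x = y")
      case False
      then show ?thesis using g yE by auto
    qed (use that in auto)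
  qed
  have union: "\<Union>?C = ?M"
  proof
    show "?M \<subseteq> \<Union>?C" using orbit_refl by blast
  qed (use sub in blast)
  have "p dvd card (\<Union>?C)"
  proof (rule dvd_partition)
    show "finite (\<Union>?C)" unfolding union using assms(3) by simp
    show "\<forall>c\<in>?C. p dvd card c"
    proof safe
      fix x g assume x: "x \<in> E" and g: "g \<in> carrier G" "\<phi> g x \<noteq> x"
      have "card (orbit G \<phi> x) dvd p ^ k"
        using orbit_stabilizer_theorem[OF x] assms(2) by (metis dvd_triv_left)
      moreover have "card (orbit G \<phi> x) \<noteq> 1"
      proof
        assume "card (orbit G \<phi> x) = 1"
        moreover have "x \<in> orbit G \<phi> x" "\<phi> g x \<in> orbit G \<phi> x"
          using orbit_refl[OF x] g(1) by (auto simp: orbit_def)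
        ultimately show False
          using g(2) by (metis card_1_singletonE singletonD)
      qed
      ultimately show "p dvd card (orbit G \<phi> x)"
        using assms(1) by (metis divides_primepow_nat dvd_power gr0I power_0)
    qed
    show "\<forall>c1\<in>?C. \<forall>c2\<in>?C. c1 \<noteq> c2 \<longrightarrow> c1 \<inter> c2 = {}"
    proof (intro ballI impI)
      fix c1 c2 assume "c1 \<in> ?C" "c2 \<in> ?C" and ne: "c1 \<noteq> c2"
      then have "c1 \<in> orbits G E \<phi>" "c2 \<in> orbits G E \<phi>"
        unfolding orbits_def by blast+
      then show "c1 \<inter> c2 = {}"
        using disjoint_union ne by blast
    qed
 qed
  then show ?thesis unfolding union .
qed

text \<open>Cauchy's theorem, read off from a subgroup of order p that Sylow's theorem supplies for
  the exponent 1.\<close>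

lemma (in group) ex_prime_order_elem:
  assumes "finite (carrier G)" and "prime p" and "p dvd order G"
  shows "\<exists>x\<in>carrier G. x \<noteq> \<one> \<and> x [^] p = \<one>"
proof -
  obtain m where "order G = p ^ 1 * m"
    using assms(3) by auto
  then obtain H where H: "subgroup H G" "card H = p ^ 1"
    using sylow_thm[OF assms(2) is_group _ assms(1)] by blast
  then have "card H > 1"
    using assms(2) prime_gt_1_nat by simp
  then have "\<not> H \<subseteq> {\<one>}"
    using card_mono[of "{\<one>}" H] by auto
  then obtain x where x: "x \<in> H" "x \<noteq> \<one>"
    by blast
  interpret H: group "G\<lparr>carrier := H\<rparr>"
    using subgroup_imp_group[OF H(1)] .
  have "x [^] p = \<one>"
    using H.pow_order_eq_1[of x] x H(2) nat_pow_consistent[of x p H] by (simp add: order_def)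
  then show ?thesis
    using x subgroup.mem_carrier[OF H(1)] by blast
qed

lemma (in group) subgroup_card_dvd_order: "subgroup H G \<Longrightarrow> card H dvd order G"
  using lagrange[of H] dvd_triv_right[of "card H" "card (rcosets H)"] by simp

lemma (in group) subgroup_card_dvd:
  assumes "subgroup H G" and "subgroup K G" and "H \<subseteq> K"
  shows "card H dvd card K"
proof -
  interpret K: group "G\<lparr>carrier := K\<rparr>"
    using subgroup_imp_group[OF assms(2)] .
  have "subgroup H (G\<lparr>carrier := K\<rparr>)"
    using assms subgroup_incl by blast
  from K.subgroup_card_dvd_order[OF this] show ?thesis
    by (simp add: order_def)
qed

lemma (in group) subgroup_pow_card_eq_1:
  assumes "subgroup H G" and "x \<in> H"
  shows "x [^] card H = \<one>"
proof -
  interpret H: group "G\<lparr>carrier := H\<rparr>"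
    using subgroup_imp_group[OF assms(1)] .
  show ?thesis
    using H.pow_order_eq_1[of x] assms(2) nat_pow_consistent[of x "card H" H]
    by (simp add: order_def)
qed

text \<open>By Cauchy, a prime q dividing the order of H yields an element whose order divides both
  q and a power of p, which forces q = p.\<close>

lemma (in group) primary_card:
  assumes H: "subgroup H G" and "finite (carrier G)" and "prime p"
    and exp: "\<And>x. x \<in> H \<Longrightarrow> x [^] (p ^ k) = \<one>"
  shows "\<exists>j. card H = p ^ j"
proof -
  interpret H: group "G\<lparr>carrier := H\<rparr>"
    using subgroup_imp_group[OF H(1)] .
  have fin: "finite H"
    using subgroup.subset[OF H] assms(2) finite_subset by blast
  have "card H \<noteq> 0"
    using fin subgroup.one_closed[OF H] by auto
  have only: "q = p" if q: "prime q" "q dvd card H" for q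
  proof -
    obtain x where x: "x \<in> H" "x \<noteq> \<one>" "x [^] q = \<one>"
      using H.ex_prime_order_elem[OF _ q(1)] q(2) fin
      unfolding nat_pow_consistent[symmetric] by (auto simp: order_def)
    have xG: "x \<in> carrier G"
      using x(1) subgroup.mem_carrier[OF H] by blast
    have "ord x dvd q" "ord x dvd p ^ k" "ord x \<noteq> 1"
      using x exp[OF x(1)] pow_eq_id[OF xG] ord_eq_1[OF xG] by auto
    then show ?thesis
      using q(1) \<open>prime p\<close> by (metis prime_dvd_power prime_nat_iff primes_dvd_imp_eq)
  qed
  obtain m where m: "card H = p ^ multiplicity p (card H) * m" "\<not> p dvd m"
    using multiplicity_decompose'[of "card H" p] \<open>card H \<noteq> 0\<close> \<open>prime p\<close>
    by (metis not_prime_unit)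
  have "m = 1"
  proof (rule ccontr)
    assume "m \<noteq> 1"
    then obtain q where "prime q" "q dvd m"
      using prime_factor_nat by blast
    then show False
      using m only[of q] by (metis dvd_mult)
  qed
  then show ?thesis
    using m(1) by auto
qed

text \<open>Meant for c the order of A_q and f the number of its fixed points. The difference is q -
  1, q (q - 1) or (q + 1) (q - 1). A prime p > q divides neither q nor q - 1, so it divides q + 1
  and equals it; the only consecutive primes are 2 and 3.\<close>

lemma two_three_of_dvd:
  fixes p q :: nat
  assumes "prime p" "prime q" "q < p"
    and c: "c = q \<or> c = q ^ 2" and f: "f = 1 \<or> f = q \<or> f = q ^ 2"
    and "f < c" "p dvd c - f"
  shows "p = 3 \<and> q = 2 \<and> f = 1"
proof -
  have q1: "q > 1"
    using assms(2) prime_gt_1_nat by blast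
  have small: "\<not> p dvd q - 1" "\<not> p dvd q"
    using q1 assms(3) by (auto dest!: dvd_imp_le)
  have "\<not> (c = q ^ 2 \<and> f = q)"
  proof
    assume "c = q ^ 2 \<and> f = q"
    then have "c - f = q * (q - 1)"
      by (simp add: power2_eq_square diff_mult_distrib2)
    then show False
      using small assms(1,7) by (simp add: prime_dvd_mult_iff)
  qed
  then have cf: "c = q ^ 2" "f = 1"
    using small c f assms(6,7) q1 power_strict_increasing[of 1 2 q] by auto
  have "c - f = (q + 1) * (q - 1)"
    using cf q1 by (simp add: power2_eq_square algebra_simps diff_mult_distrib2)
  then have "p dvd q + 1"
    using small assms(1,7) by (metis prime_dvd_mult_iff)
  then have p_eq: "p = q + 1"
    using dvd_imp_le[of p "q + 1"] assms(3) by auto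
  have "q = 2"
  proof (rule ccontr)
    assume "q \<noteq> 2"
    then have "odd q"
      using assms(2) q1 prime_odd_nat[of q] by simp
    then have "even p"
      using p_eq by simp
    then show False
      using assms(1,3) q1 prime_odd_nat[of p] by auto
  qed
  then show ?thesis
    using p_eq cf by simp
qed

section \<open>The brace of a symmetric group\<close>

context takeuchi_symmetric_group
begin

lemma lact_closed [simp, intro]:
  assumes "a \<in> carrier G" "u \<in> carrier G"
  shows "lact a u \<in> carrier G"
  using bij_betwE[OF bij_braiding] assms unfolding lact_def
  by (metis SigmaI mem_Times_iff)

lemma ract_closed [simp, intro]:
  assumes "a \<in> carrier G" "u \<in> carrier G"
  shows "ract a u \<in> carrier G"
  using bij_betwE[OF bij_braiding] assms unfolding ract_def
  by (metis SigmaI mem_Times_iff)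

lemma lact_inv_lact [simp]:
  "\<lbrakk>a \<in> carrier G; u \<in> carrier G\<rbrakk> \<Longrightarrow> lact (inv a) (lact a u) = u"
  using mult_lact[of "inv a" a u] one_lact by simp

lemma lact_lact_inv [simp]:
  "\<lbrakk>a \<in> carrier G; u \<in> carrier G\<rbrakk> \<Longrightarrow> lact a (lact (inv a) u) = u"
  using mult_lact[of a "inv a" u] one_lact by simp

lemma lact_lact_ract:
  assumes "a \<in> carrier G" "u \<in> carrier G"
  shows "lact (lact a u) (ract a u) = a"
  using involutive[of "(a, u)"] assms unfolding lact_def ract_def by simp

text \<open>Involutivity makes the right action a function of the left one, so that from here on
  \<open>lact\<close> carries all the information.\<close>

lemma ract_eq:
  assumes "a \<in> carrier G" "u \<in> carrier G"
  shows "ract a u = lact (inv (lact a u)) a"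
  using lact_inv_lact[of "lact a u" "ract a u"] lact_lact_ract[OF assms] assms by simp

text \<open>Both sides are the action of the one element \<open>a \<otimes> u\<close>, factored in
  the two ways given by \<open>compatible\<close>.\<close>

lemma lact_commute:
  assumes "a \<in> carrier G" "u \<in> carrier G" "x \<in> carrier G"
  shows "lact a (lact u x) = lact (lact a u) (lact (ract a u) x)"
  using assms compatible[of a u] mult_lact[of a u x] mult_lact[of "lact a u" "ract a u" x] by simp

definition gplus (infixl \<open>\<boxplus>\<close> 65) where "a \<boxplus> b = a \<otimes> lact (inv a) b"

definition add_group :: "'a monoid"
  where "add_group = \<lparr>carrier = carrier G, monoid.mult = gplus, one = \<one>\<rparr>"

lemma add_group_simps [simp]:
  "carrier add_group = carrier G" "monoid.mult add_group = gplus" "one add_group = \<one>"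
  "order add_group = order G"
  by (simp_all add: add_group_def order_def)

lemma plus_closed [simp, intro]:
  "\<lbrakk>a \<in> carrier G; b \<in> carrier G\<rbrakk> \<Longrightarrow> a \<boxplus> b \<in> carrier G"
  by (simp add: gplus_def)

lemma plus_lact: "\<lbrakk>a \<in> carrier G; b \<in> carrier G\<rbrakk> \<Longrightarrow> a \<boxplus> lact a b = a \<otimes> b"
  by (simp add: gplus_def)

lemma plus_commute:
  assumes "a \<in> carrier G" "b \<in> carrier G"
  shows "a \<boxplus> b = b \<boxplus> a"
proof -
  \<comment> \<open>With this choice \<open>lact a ?u\<close> is b, so compatibility exchanges the
    roles of a and b.\<close>
  let ?u = "lact (inv a) b"
  have "a \<otimes> ?u = lact a ?u \<otimes> ract a ?u"
    using assms by (intro compatible) auto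
  also have "\<dots> = b \<otimes> lact (inv b) a"
    using assms by (simp add: ract_eq)
  finally show ?thesis
    by (simp add: gplus_def)
qed

text \<open>The expansion of a product under \<open>lact a\<close> is twisted by
  \<open>ract a b\<close>; the twist is exactly what \<open>lact_commute\<close> trades for
  \<open>lact a\<close> followed by the inverse of \<open>lact a b\<close>, as the definition of
  \<boxplus> demands.\<close>

lemma lact_plus:
  assumes "a \<in> carrier G" "b \<in> carrier G" "c \<in> carrier G"
  shows "lact a (b \<boxplus> c) = lact a b \<boxplus> lact a c"
proof -
  have "lact a (lact b (lact (inv b) c)) = lact (lact a b) (lact (ract a b) (lact (inv b) c))"
    using assms by (intro lact_commute) auto
  then have "lact (ract a b) (lact (inv b) c) = lact (inv (lact a b)) (lact a c)"
    using assms by simp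
  then show ?thesis
    using assms by (simp add: gplus_def lact_mult)
qed

lemma plus_assoc:
  assumes "a \<in> carrier G" "b \<in> carrier G" "c \<in> carrier G"
  shows "a \<boxplus> b \<boxplus> c = a \<boxplus> (b \<boxplus> c)"
proof -
  let ?u = "lact (inv a) b"
  have "a \<boxplus> (b \<boxplus> c) = a \<otimes> (?u \<boxplus> lact (inv a) c)"
    using assms by (simp add: gplus_def[of a] lact_plus)
  also have "\<dots> = a \<otimes> ?u \<otimes> lact (inv ?u) (lact (inv a) c)"
    using assms by (simp add: gplus_def m_assoc)
  also have "\<dots> = a \<otimes> ?u \<otimes> lact (inv (a \<otimes> ?u)) c"
    using assms by (simp add: inv_mult_group mult_lact)
  finally show ?thesis
    by (simp add: gplus_def)
qed

lemma comm_group_add_group: "comm_group add_group"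
proof (rule comm_groupI)
  fix a assume "a \<in> carrier add_group"
  then have a: "a \<in> carrier G" by simp
  then have "lact a (inv a) \<boxplus> a = \<one>"
    by (simp add: plus_lact plus_commute)
  with a show "\<exists>b\<in>carrier add_group. b \<otimes>\<^bsub>add_group\<^esub> a = \<one>\<^bsub>add_group\<^esub>"
    by (intro bexI[of _ "lact a (inv a)"]) auto
next
  fix a b assume "a \<in> carrier add_group" "b \<in> carrier add_group"
  then show "a \<otimes>\<^bsub>add_group\<^esub> b = b \<otimes>\<^bsub>add_group\<^esub> a"
    by (simp add: plus_commute)
qed (simp_all add: plus_assoc, simp add: gplus_def one_lact)

sublocale add: comm_group add_group
  rewrites "carrier add_group = carrier G" and "monoid.mult add_group = gplus"
    and "one add_group = \<one>" and "order add_group = order G"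
  using comm_group_add_group by simp_all

lemma lact_pow_add:
  "\<lbrakk>a \<in> carrier G; x \<in> carrier G\<rbrakk>
    \<Longrightarrow> lact a (x [^]\<^bsub>add_group\<^esub> (n::nat)) = lact a x [^]\<^bsub>add_group\<^esub> n"
proof (induction n)
  case 0
  then show ?case by (simp add: lact_one)
next
  case (Suc n)
  then show ?case using add.nat_pow_closed[of x n] by (simp add: lact_plus)
qed

lemma lact_inj:
  "\<lbrakk>a \<in> carrier G; x \<in> carrier G; y \<in> carrier G; lact a x = lact a y\<rbrakk> \<Longrightarrow> x = y"
  by (metis lact_inv_lact)

section \<open>Fixed points, stabilizers and primary components of the left action\<close>

definition fixed :: "'a set \<Rightarrow> 'a set"
  where "fixed H = {x \<in> carrier G. \<forall>h\<in>H. lact h x = x}"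

lemma subgroup_fixed:
  assumes "H \<subseteq> carrier G"
  shows "subgroup (fixed H) add_group"
proof (rule add.subgroupI)
  fix x assume x: "x \<in> fixed H"
  show "inv\<^bsub>add_group\<^esub> x \<in> fixed H"
    unfolding fixed_def
  proof (safe)
    show xi: "inv\<^bsub>add_group\<^esub> x \<in> carrier G"
      using x add.inv_closed by (simp add: fixed_def)
    fix h assume h: "h \<in> H"
    then have hG: "h \<in> carrier G" using assms by blast
    have "lact h (inv\<^bsub>add_group\<^esub> x) \<boxplus> x = lact h (inv\<^bsub>add_group\<^esub> x \<boxplus> x)"
      using x h hG lact_plus[OF hG xi, of x] by (simp add: fixed_def)
    also have "\<dots> = \<one>"
      using x hG by (simp add: fixed_def lact_one)
    finally show "lact h (inv\<^bsub>add_group\<^esub> x) = inv\<^bsub>add_group\<^esub> x"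
      using x xi hG add.inv_equality[of "lact h (inv\<^bsub>add_group\<^esub> x)" x] by (simp add: fixed_def)
  qed
next
  show "fixed H \<noteq> {}"
    using assms lact_one by (auto simp: fixed_def)
qed (use assms in \<open>auto simp: fixed_def lact_plus subset_iff\<close>)

definition pointwise_stabilizer :: "'a set \<Rightarrow> 'a set"
  where "pointwise_stabilizer S = {a \<in> carrier G. \<forall>x\<in>S. lact a x = x}"

lemma subgroup_pointwise_stabilizer:
  assumes "S \<subseteq> carrier G"
  shows "subgroup (pointwise_stabilizer S) G"
proof (rule subgroupI)
  fix a assume "a \<in> pointwise_stabilizer S"
  with assms show "inv a \<in> pointwise_stabilizer S"
    by (auto simp: pointwise_stabilizer_def subset_iff) (metis lact_inv_lact)
next
  show "pointwise_stabilizer S \<noteq> {}"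
    using assms one_lact by (auto simp: pointwise_stabilizer_def subset_iff)
qed (use assms in \<open>auto simp: pointwise_stabilizer_def mult_lact subset_iff\<close>)

abbreviation socle where "socle \<equiv> pointwise_stabilizer (carrier G)"

definition lact_stable :: "'a set \<Rightarrow> bool"
  where "lact_stable S \<longleftrightarrow> S \<subseteq> carrier G \<and> (\<forall>a\<in>carrier G. \<forall>x\<in>S. lact a x \<in> S)"

lemma lact_group_action:
  assumes H: "subgroup H G" and S: "S \<subseteq> carrier G" "\<And>h x. h \<in> H \<Longrightarrow> x \<in> S \<Longrightarrow> lact h x \<in> S"
  shows "group_action (G\<lparr>carrier := H\<rparr>) S (\<lambda>h. restrict (lact h) S)"
proof -
  have HG: "h \<in> carrier G" if "h \<in> H" for h
    using that subgroup.mem_carrier[OF H] by blast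
  \<comment> \<open>The elements of \<open>Bij S\<close> are extensional functions, hence the
    restriction of \<open>lact h\<close> to S.\<close>
  have bij: "restrict (lact h) S \<in> Bij S" if h: "h \<in> H" for h
  proof -
    have "bij_betw (lact h) S S"
      using S h HG[OF h] subgroup.m_inv_closed[OF H h]
      by (intro bij_betw_byWitness[where f' = "lact (inv h)"]) (auto simp: subset_iff)
    then show ?thesis
      by (simp add: Bij_def)
  qed
  have "restrict (lact (g \<otimes> h)) S = compose S (restrict (lact g) S) (restrict (lact h) S)"
    if "g \<in> H" "h \<in> H" for g h
    using that S HG by (auto simp: compose_def mult_lact subset_iff fun_eq_iff restrict_def)
  then have "(\<lambda>h. restrict (lact h) S) \<in> hom (G\<lparr>carrier := H\<rparr>) (BijGroup S)"
    using bij by (auto simp: hom_def BijGroup_def)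
  then show ?thesis
    unfolding group_action_def group_hom_def group_hom_axioms_def
    using group_BijGroup subgroup_imp_group[OF H] by blast
qed

lemma p_subgroup_fixed_points:
  assumes H: "subgroup H G" and S: "S \<subseteq> carrier G" "\<And>h x. h \<in> H \<Longrightarrow> x \<in> S \<Longrightarrow> lact h x \<in> S"
    and "prime p" "card H = p ^ k" and fin: "finite S"
  shows "p dvd card S - card (S \<inter> fixed H)"
proof -
  interpret group_action "G\<lparr>carrier := H\<rparr>" S "\<lambda>h. restrict (lact h) S"
    using lact_group_action[OF H S] by blast
  have "{x \<in> S. \<exists>g\<in>H. lact g x \<noteq> x} = S - (S \<inter> fixed H)"
    using S by (auto simp: fixed_def)
  moreover have "p dvd card {x \<in> S. \<exists>g\<in>H. lact g x \<noteq> x}"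
    using p_group_moved_points[of p k] assms by (simp add: order_def cong: conj_cong)
  ultimately show ?thesis
    using fin by (simp add: card_Diff_subset)
qed

text \<open>The exponent 2 suffices because only cube-free orders are considered.\<close>

definition primary :: "nat \<Rightarrow> 'a set"
  where "primary p = {x \<in> carrier G. x [^]\<^bsub>add_group\<^esub> (p ^ 2) = \<one>}"

lemma lact_stable_primary: "lact_stable (primary p)"
  by (auto simp: lact_stable_def primary_def lact_pow_add[symmetric] lact_one)

lemma subgroup_primary_add: "subgroup (primary p) add_group"
proof (rule add.subgroupI)
  show "primary p \<noteq> {}"
    using add.nat_pow_one by (auto simp: primary_def)
qed (auto simp: primary_def add.nat_pow_distrib add.nat_pow_inv)

text \<open>On a stable set the two structures differ only by the action:
  \<open>a \<otimes> b\<close> is \<open>a \<boxplus> lact a b\<close>, and the multiplicative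
  inverse is the additive one moved by \<open>lact (inv a)\<close>.\<close>

lemma lact_stable_subgroup:
  assumes "lact_stable S" and "subgroup S add_group"
  shows "subgroup S G"
proof (rule subgroupI)
  show "S \<subseteq> carrier G" and "S \<noteq> {}"
    using assms subgroup.one_closed[OF assms(2)] by (auto simp: lact_stable_def)
  fix a assume a: "a \<in> S"
  then have aG: "a \<in> carrier G"
    using assms(1) by (auto simp: lact_stable_def)
  have "inv a = lact (inv a) (inv\<^bsub>add_group\<^esub> a)"
  proof -
    have "a \<otimes> lact (inv a) (inv\<^bsub>add_group\<^esub> a) = \<one>"
      using add.r_inv[of a] aG by (simp add: gplus_def)
    then show ?thesis
      using aG add.inv_closed[OF aG] by (metis inv_equality inv_inv lact_closed inv_closed)
  qed
  then show "inv a \<in> S"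
    using a aG assms subgroup.m_inv_closed[OF assms(2) a] by (metis inv_closed lact_stable_def)
  fix b assume "b \<in> S"
  then have "b \<in> carrier G" "lact a b \<in> S"
    using aG assms(1) by (auto simp: lact_stable_def)
  then show "a \<otimes> b \<in> S"
    using a aG plus_lact[of a b] subgroup.m_closed[OF assms(2) a, of "lact a b"] by simp
qed

lemma subgroup_primary: "subgroup (primary p) G"
  by (rule lact_stable_subgroup[OF lact_stable_primary subgroup_primary_add])

lemma lact_eq_imp_pow_eq:
  assumes "lact_stable S" "a \<in> carrier G" "b \<in> carrier G"
    and "\<And>x. x \<in> S \<Longrightarrow> lact a x = lact b x" and "x \<in> S"
  shows "lact (a [^] (n::nat)) x = lact (b [^] n) x"
  using \<open>x \<in> S\<close>
proof (induction n arbitrary: x)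
  case (Suc n)
  then show ?case using assms by (simp add: mult_lact lact_stable_def subset_iff)
qed simp

text \<open>Two elements of coprime orders that act alike act trivially: raise both to a power that is
  the identity on one factor and kills the other.\<close>

lemma lact_trivial_of_coprime:
  assumes S: "lact_stable S" and a: "a \<in> carrier G" and b: "b \<in> carrier G"
    and eq: "\<And>x. x \<in> S \<Longrightarrow> lact a x = lact b x" and x: "x \<in> S"
    and "a [^] (m::nat) = \<one>" "b [^] (n::nat) = \<one>" "coprime m n" "n > 0"
  shows "lact a x = x"
proof -
  obtain u v where uv: "n * u = m * v + 1"
    using bezout_nat[of n m] \<open>coprime m n\<close> \<open>n > 0\<close> by (auto simp: coprime_iff_gcd_eq_1 gcd.commute)
  have "a [^] (n * u) = (a [^] m) [^] v \<otimes> a"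
    using a by (simp add: uv nat_pow_pow nat_pow_mult[symmetric] del: nat_pow_Suc)
  then have "a [^] (n * u) = a"
    using a assms(6) by simp
  moreover have "b [^] (n * u) = \<one>"
    using b assms(7) nat_pow_pow[OF b, of n u] by simp
  ultimately show ?thesis
    using lact_eq_imp_pow_eq[OF S a b eq x, of "n * u"] x S one_lact
    by (auto simp: lact_stable_def)
qed

lemma primary_subset: "primary p \<subseteq> carrier G"
  by (auto simp: primary_def)

lemma primary_lact: "\<lbrakk>a \<in> carrier G; x \<in> primary p\<rbrakk> \<Longrightarrow> lact a x \<in> primary p"
  using lact_stable_primary by (auto simp: lact_stable_def)

lemma one_in_fixed: "H \<subseteq> carrier G \<Longrightarrow> \<one> \<in> fixed H"
  by (auto simp: fixed_def lact_one)

text \<open>The group K_p of the overview: the socle of the brace A_p, which is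
  \<open>primary p\<close>, taken on its own.\<close>

definition self_kernel :: "nat \<Rightarrow> 'a set"
  where "self_kernel p = primary p \<inter> pointwise_stabilizer (primary p)"

lemma subgroup_self_kernel: "subgroup (self_kernel p) G"
  unfolding self_kernel_def
  using subgroup_primary subgroup_pointwise_stabilizer[OF primary_subset] subgroups_Inter_pair
  by blast

lemma self_kernel_subset: "self_kernel p \<subseteq> carrier G"
  using primary_subset by (auto simp: self_kernel_def)

end

section \<open>Cube-free order: the socle is nontrivial\<close>

locale cube_free_symmetric_group = takeuchi_symmetric_group +
  assumes fin: "finite (carrier G)" and cube_free: "cube_free (order G)"
begin

lemma finite_primary: "finite (primary p)"
  using fin primary_subset finite_subset by blast

text \<open>All elements of H are killed by p^2, so its order is a power of p; Lagrange and
  cube-freeness bound the exponent by 2.\<close>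

lemma card_subgroup_primary:
  assumes "prime p" and H: "subgroup H add_group" "H \<subseteq> primary p"
  shows "card H = 1 \<or> card H = p \<or> card H = p ^ 2"
proof -
  obtain j where j: "card H = p ^ j"
    using add.primary_card[OF H(1) _ assms(1), of 2] fin H(2) by (auto simp: primary_def)
  have "p ^ j dvd order G"
    using add.subgroup_card_dvd_order[OF H(1)] j by simp
  then have "\<not> j \<ge> 3"
    using cube_free assms(1) unfolding cube_free_def by (metis le_imp_power_dvd dvd_trans)
  then have "j = 0 \<or> j = 1 \<or> j = 2"
    by linarith
  then show ?thesis
    using j by auto
qed

lemma card_primary:
  assumes "prime p" "p dvd order G"
  shows "card (primary p) = p \<or> card (primary p) = p ^ 2"
proof -
  obtain x where x: "x \<in> carrier G" "x \<noteq> \<one>" "x [^]\<^bsub>add_group\<^esub> p = \<one>"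
    using add.ex_prime_order_elem[of p] assms fin by auto
  then have "x [^]\<^bsub>add_group\<^esub> (p ^ 2) = \<one>"
    using add.nat_pow_pow[of x p p] add.nat_pow_one by (simp add: power2_eq_square)
  then have "x \<in> primary p"
    using x by (simp add: primary_def)
  moreover have "\<one> \<in> primary p"
    using subgroup.one_closed[OF subgroup_primary] .
  ultimately have "card (primary p) \<noteq> 1"
    using x(2) by (metis card_1_singletonE singletonD)
  then show ?thesis
    using card_subgroup_primary[OF assms(1) subgroup_primary_add] by blast
qed

text \<open>The points fixed by y form an additive subgroup. It contains an additive Sylow subgroup
  for every prime, because cube-freeness puts these inside the primary components; hence its order
  is divisible by that of G.\<close>

lemma primary_fixed_imp_socle:
  assumes y: "y \<in> carrier G"
    and *: "\<And>q x. \<lbrakk>prime q; q dvd order G; x \<in> primary q\<rbrakk> \<Longrightarrow> lact y x = x"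
  shows "y \<in> socle"
proof -
  have sub: "subgroup (fixed {y}) add_group"
    using subgroup_fixed y by simp
  have "order G dvd card (fixed {y})"
  proof (rule multiplicity_le_imp_dvd)
    show "order G \<noteq> 0"
      using cube_free by (simp add: cube_free_def)
    fix q :: nat assume q: "prime q"
    let ?a = "multiplicity q (order G)"
    show "?a \<le> multiplicity q (card (fixed {y}))"
    proof (cases "?a = 0")
      case False
      have dvd: "q ^ ?a dvd order G"
        by (rule multiplicity_dvd)
      then have "\<not> ?a \<ge> 3"
        using cube_free q unfolding cube_free_def by (metis le_imp_power_dvd dvd_trans)
      then have le: "?a \<le> 2" by simp
      have q_dvd: "q dvd order G"
        using dvd False by (metis dvd_power dvd_trans gr0I)
      obtain m where "order G = q ^ ?a * m"
        using dvd by (metis dvdE)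
      then obtain P where P: "subgroup P add_group" "card P = q ^ ?a"
        using sylow_thm[OF q add.is_group, of ?a m] fin by auto
      have "P \<subseteq> fixed {y}"
      proof
        fix x assume x: "x \<in> P"
        then have xG: "x \<in> carrier G"
          using subgroup.mem_carrier[OF P(1)] by simp
        have "x [^]\<^bsub>add_group\<^esub> (q ^ ?a) = \<one>"
          using add.subgroup_pow_card_eq_1[OF P(1) x] P(2) by simp
        moreover have "q ^ 2 = q ^ ?a * q ^ (2 - ?a)"
          using le by (simp flip: power_add)
        ultimately have "x [^]\<^bsub>add_group\<^esub> (q ^ 2) = \<one>"
          using add.nat_pow_pow[OF xG, of "q ^ ?a" "q ^ (2 - ?a)"] add.nat_pow_one by simp
        then have "x \<in> primary q"
          using xG by (simp add: primary_def)
        then show "x \<in> fixed {y}"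
          using *[OF q q_dvd] xG by (simp add: fixed_def)
      qed
      then have "q ^ ?a dvd card (fixed {y})"
        using add.subgroup_card_dvd[OF P(1) sub] P(2) by simp
      moreover have "card (fixed {y}) \<noteq> 0"
        using fin one_in_fixed[of "{y}"] y finite_subset[of "fixed {y}" "carrier G"]
        by (auto simp: fixed_def)
      ultimately show ?thesis
        using q by (intro multiplicity_geI) auto
    qed simp
  qed
  moreover have "fixed {y} \<subseteq> carrier G"
    by (auto simp: fixed_def)
  ultimately have "fixed {y} = carrier G"
    using fin card_subset_eq[of "carrier G" "fixed {y}"] add.subgroup_card_dvd_order[OF sub]
    by (metis dvd_antisym order_def)
  then show ?thesis
    using y by (auto simp: pointwise_stabilizer_def fixed_def)
qed

text \<open>A_p acts on itself as a p-group, so p divides the number of its fixed points. If all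
  points are fixed, K_p is A_p; otherwise there are p fixed points among p^2, and a single moved
  point v decides.\<close>

lemma self_kernel_nontrivial:
  assumes p: "prime p" "p dvd order G"
  shows "\<exists>y\<in>self_kernel p. y \<noteq> \<one>"
proof -
  let ?A = "primary p"
  let ?F = "?A \<inter> fixed ?A"
  have p1: "p > 1"
    using p(1) prime_gt_1_nat by blast
  then have p2: "p < p ^ 2"
    by (simp add: power2_eq_square)
  obtain k where k: "card ?A = p ^ k" "k = 1 \<or> k = 2"
    using card_primary[OF p] by (metis power_one_right)
  have one: "\<one> \<in> ?A"
    using subgroup.one_closed[OF subgroup_primary] .
  have subF: "subgroup ?F add_group"
    using add.subgroups_Inter_pair[OF subgroup_primary_add subgroup_fixed[OF primary_subset]] .
  have cF: "card ?F = 1 \<or> card ?F = p \<or> card ?F = p ^ 2"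
    using card_subgroup_primary[OF p(1) subF] by simp
  have "p dvd card ?A - card ?F"
    using p_subgroup_fixed_points[OF subgroup_primary primary_subset _ p(1) k(1) finite_primary]
      primary_lact primary_subset by blast
  moreover have le: "card ?F \<le> card ?A"
    using finite_primary by (intro card_mono) auto
  moreover have "p dvd card ?A"
    using k by auto
  ultimately have "p dvd card ?F"
    by (metis dvd_diffD1)
  then have cF: "card ?F = p \<or> card ?F = p ^ 2"
    using cF p1 by auto
  show ?thesis
  proof (cases "?F = ?A")
    case True
    then have "self_kernel p = ?A"
      by (auto simp: self_kernel_def pointwise_stabilizer_def fixed_def primary_def)
    moreover have "?A \<noteq> {\<one>}"
      using k p1 by (metis card_1_singleton_iff less_irrefl One_nat_def one_less_power zero_less_one
          zero_less_numeral)
    ultimately show ?thesis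
      using one by blast
  next
    case False
    then have "card ?F < card ?A"
      using finite_primary by (intro psubset_card_mono) auto
    then have cA: "card ?A = p ^ 2" and cFp: "card ?F = p"
      using cF k p2 by auto
    \<comment> \<open>The orbit of v misses the identity, which is fixed by everything. It is
      therefore smaller than A_p, and the stabilizer of v contains some y other than the
      identity.\<close>
    obtain v where v: "v \<in> ?A" "v \<notin> ?F"
      using False by blast
    interpret group_action "G\<lparr>carrier := ?A\<rparr>" ?A "\<lambda>h. restrict (lact h) ?A"
      using lact_group_action[OF subgroup_primary primary_subset] primary_lact primary_subset
      by blast
    let ?O = "orbit (G\<lparr>carrier := ?A\<rparr>) (\<lambda>h. restrict (lact h) ?A) v"
    let ?S = "stabilizer (G\<lparr>carrier := ?A\<rparr>) (\<lambda>h. restrict (lact h) ?A) v"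
    have S_eq: "?S = {h \<in> ?A. lact h v = v}"
      using v by (auto simp: stabilizer_def)
    have "card ?O * card ?S = card ?A"
      using orbit_stabilizer_theorem[OF v(1)] by (simp add: order_def)
    moreover have "card ?O < card ?A"
    proof (rule psubset_card_mono[OF finite_primary])
      have "v \<noteq> \<one>"
        using v one one_in_fixed[OF primary_subset] by blast
      then have "\<one> \<notin> ?O"
        using v primary_subset lact_inj[of _ v \<one>] lact_one
        by (auto simp: orbit_def) (metis subsetD one_closed)
      moreover have "?O \<subseteq> ?A"
        using v primary_lact[OF subsetD[OF primary_subset]] by (auto simp: orbit_def)
      ultimately show "?O \<subset> ?A"
        using one by blast
    qed
    ultimately have "card ?S \<noteq> 1"
      by auto
    moreover have "\<one> \<in> ?S"
      using one v primary_subset one_lact by (auto simp: S_eq)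
    ultimately obtain y where y: "y \<in> ?S" "y \<noteq> \<one>"
      by (metis is_singletonI' is_singleton_altdef empty_iff)
    have yG: "y \<in> carrier G"
      using y(1) primary_subset by (auto simp: S_eq)
    let ?E = "?A \<inter> fixed {y}"
    have subE: "subgroup ?E add_group"
      using add.subgroups_Inter_pair[OF subgroup_primary_add subgroup_fixed] yG by simp
    have "y \<in> ?A" "v \<in> ?E"
      using y(1) v(1) primary_subset by (auto simp: S_eq fixed_def)
    \<comment> \<open>Besides the common fixed points, y fixes v. An additive subgroup of A_p with
      more than p elements is all of A_p, so y lies in K_p.\<close>
    then have "?F \<subset> ?E"
      using v(2) unfolding fixed_def by blast
    then have "card ?F < card ?E"
      using finite_primary by (intro psubset_card_mono) auto
    then have "card ?E = card ?A"
      using card_subgroup_primary[OF p(1) subE Int_lower1] cA cFp p1 by linarith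
    then have "?E = ?A"
      using finite_primary by (intro card_subset_eq) auto
    then have "y \<in> self_kernel p"
      using y(1) yG by (auto simp: S_eq self_kernel_def pointwise_stabilizer_def fixed_def)
    then show ?thesis
      using y(2) by blast
  qed
qed

lemma coprime_card_primary:
  assumes "prime p" "prime q" "p \<noteq> q"
  shows "coprime (card (primary p)) (card (primary q))"
proof -
  have "coprime p q"
    using assms by (rule primes_coprime)
  moreover have "\<exists>j. card (primary r) = r ^ j" if "prime r" for r
    using card_subgroup_primary[OF that subgroup_primary_add order_refl]
    by (metis power_0 power_one_right)
  ultimately show ?thesis
    using assms(1,2) by (metis coprime_power_left_iff coprime_power_right_iff)
qed

text \<open>Lagrange provides the coprime exponents. The component r acted upon is left open, since
  the argument below needs both A_p and A_q in this place.\<close>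

lemma primary_act_alike_imp_trivial:
  assumes "prime p" "prime q" "p \<noteq> q" and a: "a \<in> primary p" and b: "b \<in> primary q"
    and "\<And>x. x \<in> primary r \<Longrightarrow> lact a x = lact b x" and "x \<in> primary r"
  shows "lact a x = x"
proof (rule lact_trivial_of_coprime[OF lact_stable_primary])
  show "a [^] card (primary p) = \<one>" "b [^] card (primary q) = \<one>"
    using subgroup_pow_card_eq_1[OF subgroup_primary] a b by auto
  show "coprime (card (primary p)) (card (primary q))"
    by (rule coprime_card_primary[OF assms(1-3)])
  show "card (primary q) > 0"
    using b finite_primary card_gt_0_iff by blast
qed (use assms primary_subset in auto)

text \<open>Write a y = z b with z in A_p and b in A_q. On A_q the factor a acts trivially, on A_p
  the factor y does; what remains in each case equates the action of an element of A_p with that of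
  an element of A_q, so both are trivial there.\<close>

lemma self_kernel_fixes_self_kernel:
  assumes pq: "prime p" "prime q" "p \<noteq> q"
    and only: "\<And>r. \<lbrakk>prime r; r dvd order G\<rbrakk> \<Longrightarrow> r = p \<or> r = q"
    and soc: "socle = {\<one>}"
    and y: "y \<in> self_kernel p" and a: "a \<in> self_kernel q"
  shows "lact y a = a"
proof -
  define z where "z = lact a y"
  define b where "b = ract a y"
  have yp: "y \<in> primary p" and aq: "a \<in> primary q"
    using y a by (auto simp: self_kernel_def)
  have yG: "y \<in> carrier G" and aG: "a \<in> carrier G"
    using y a self_kernel_subset by auto
  have zp: "z \<in> primary p"
    unfolding z_def using yp aG by (rule primary_lact[rotated])
  then have zG: "z \<in> carrier G"
    using primary_subset by blast
  have b_eq: "b = lact (inv z) a"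
    unfolding b_def z_def using ract_eq[OF aG yG] .
  then have bq: "b \<in> primary q"
    using aq zG by (simp add: primary_lact)
  then have bG: "b \<in> carrier G"
    using primary_subset by blast
  have comm: "lact a (lact y x) = lact z (lact b x)" if "x \<in> carrier G" for x
    unfolding z_def b_def by (rule lact_commute[OF aG yG that])
  have on_q: "lact y x = lact z (lact b x)" if "x \<in> primary q" for x
    using that a comm[of x] primary_lact[OF yG that] primary_subset
    by (auto simp: self_kernel_def pointwise_stabilizer_def)
  have b_triv: "lact b x = x" if "x \<in> primary q" for x
  proof (rule primary_act_alike_imp_trivial[OF pq(2,1) pq(3)[symmetric] bq _ _ that])
    show "inv z \<otimes> y \<in> primary p"
      using zp yp subgroup_primary by (metis subgroup.m_closed subgroup.m_inv_closed)
    show "lact b x = lact (inv z \<otimes> y) x" if "x \<in> primary q" for x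
      using on_q[OF that] that primary_subset zG yG bG by (auto simp: mult_lact subset_iff)
  qed
  \<comment> \<open>On A_p the identity becomes: c acts like z. As c lies in A_q, it acts trivially
    there, and on A_q both of its factors are trivial; so c is in the socle and a = b.\<close>
  define c where "c = a \<otimes> inv b"
  have cq: "c \<in> primary q"
    unfolding c_def using aq bq subgroup_primary by (metis subgroup.m_closed subgroup.m_inv_closed)
  have cG: "c \<in> carrier G"
    using cq primary_subset by blast
  have c_q: "lact c x = x" if "x \<in> primary q" for x
  proof -
    have xG: "x \<in> carrier G" using that primary_subset by blast
    have "lact (inv b) x = x"
      using b_triv[OF that] lact_inv_lact[OF bG xG] by simp
    then show ?thesis
      using a that xG aG bG by (auto simp: c_def mult_lact self_kernel_def pointwise_stabilizer_def)
  qed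
  have c_p: "lact c x = x" if "x \<in> primary p" for x
  proof (rule primary_act_alike_imp_trivial[OF pq(2,1) pq(3)[symmetric] cq zp _ that])
    fix x assume x: "x \<in> primary p"
    then have xG: "x \<in> carrier G" and x': "lact (inv b) x \<in> primary p" "lact (inv b) x \<in> carrier G"
      using primary_subset primary_lact bG by auto
    have "lact y (lact (inv b) x) = lact (inv b) x"
      using y x' by (auto simp: self_kernel_def pointwise_stabilizer_def)
    then have "lact a (lact (inv b) x) = lact z x"
      using comm[OF x'(2)] bG xG by simp
    then show "lact c x = lact z x"
      using aG bG xG by (simp add: c_def mult_lact)
  qed
  have "c \<in> socle"
    using primary_fixed_imp_socle[OF cG] only c_q c_p by blast
  then have "a \<otimes> inv b = \<one>"
    using soc by (simp add: c_def)
  then have "a = b"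
    using aG bG by (metis inv_closed inv_equality inv_inv)
  \<comment> \<open>Since b is a moved by the inverse of z, equality of a and b says that z fixes a;
    on A_q the action of y agrees with that of z, because b is trivial there.\<close>
  then have "lact z a = a"
    using b_eq lact_lact_inv[OF zG aG] by simp
  then show ?thesis
    using on_q[OF aq] b_triv[OF aq] by simp
qed

lemma socle_nontrivial:
  assumes "order G \<noteq> 1"
  shows "socle \<noteq> {\<one>}"
proof
  assume soc: "socle = {\<one>}"
  have order: "order G \<noteq> 0"
    using cube_free by (simp add: cube_free_def)
  \<comment> \<open>Taking the largest prime divisor gives q < p for every other one, as
    \<open>two_three_of_dvd\<close> requires.\<close>
  define p where "p = Max (prime_factors (order G))"
  have ne: "prime_factors (order G) \<noteq> {}"
    using order assms prime_factor_nat[OF assms] by (auto simp: prime_factors_dvd)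
  then have "p \<in> prime_factors (order G)"
    unfolding p_def by (intro Max_in) auto
  then have p: "prime p" "p dvd order G"
    by auto
  have max: "q \<le> p" if "prime q" "q dvd order G" for q
    unfolding p_def using that order by (intro Max_ge) (auto simp: prime_factors_dvd)
  obtain j where j: "card (self_kernel p) = p ^ j"
  proof -
    have "card (self_kernel p) dvd card (primary p)"
      using subgroup_card_dvd[OF subgroup_self_kernel subgroup_primary] by (auto simp: self_kernel_def)
    moreover have "\<exists>k. card (primary p) = p ^ k"
      using card_primary[OF p] by (metis power_one_right)
    ultimately show ?thesis
      using that p(1) by (metis divides_primepow_nat)
  qed
  obtain y where y: "y \<in> self_kernel p" "y \<noteq> \<one>"
    using self_kernel_nontrivial[OF p] by blast
  have "primary q \<inter> fixed (self_kernel p) = primary q" if q: "prime q" "q dvd order G" "q \<noteq> p" for q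
  proof (rule ccontr)
    let ?F = "primary q \<inter> fixed (self_kernel p)"
    assume "?F \<noteq> primary q"
    then have less: "card ?F < card (primary q)"
      using finite_primary by (intro psubset_card_mono) auto
    have "p dvd card (primary q) - card ?F"
      using p_subgroup_fixed_points[OF subgroup_self_kernel primary_subset _ p(1) j finite_primary]
        primary_lact self_kernel_subset by blast
    moreover have "card ?F = 1 \<or> card ?F = q \<or> card ?F = q ^ 2"
      using add.subgroups_Inter_pair[OF subgroup_primary_add subgroup_fixed[OF self_kernel_subset]]
      by (intro card_subgroup_primary q) auto
    moreover have "q < p"
      using max q by (simp add: le_neq_implies_less)
    ultimately have *: "p = 3" "q = 2" "card ?F = 1"
      using two_three_of_dvd[OF p(1) q(1) _ card_primary[OF q(1,2)] _ less] by auto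
    have only: "r = p \<or> r = q" if "prime r" "r dvd order G" for r
    proof -
      have "2 \<le> r" "r \<le> 3"
        using max[OF that] that(1) * prime_ge_2_nat by auto
      then show ?thesis using * by auto
    qed
    obtain a where a: "a \<in> self_kernel q" "a \<noteq> \<one>"
      using self_kernel_nontrivial[OF q(1,2)] by blast
    \<comment> \<open>In the exceptional case the identity is the only point of A_2 fixed by K_3,
      whereas every element of K_2 is such a point.\<close>
    have "a \<in> ?F"
      using self_kernel_fixes_self_kernel[OF p(1) q(1) q(3)[symmetric] only soc _ a(1)] a(1) self_kernel_subset
      by (auto simp: fixed_def self_kernel_def)
    moreover have "\<one> \<in> ?F"
      using subgroup.one_closed[OF subgroup_primary] one_in_fixed[OF self_kernel_subset] by blast
    ultimately show False
      using a(2) *(3) by (metis card_1_singletonE singletonD)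
  qed
  then have "lact y x = x" if "prime q" "q dvd order G" "x \<in> primary q" for q x
    using that y(1) by (cases "q = p") (auto simp: fixed_def self_kernel_def pointwise_stabilizer_def)
  then have "y \<in> socle"
    using primary_fixed_imp_socle y(1) self_kernel_subset by blast
  then show False
    using soc y(2) by blast
qed

end

section \<open>Retraction as the quotient by the socle\<close>

text \<open>The defining identities pass along a surjective homomorphism that intertwines the two
  braidings; bijectivity of \<open>s\<close> comes from its being its own inverse.\<close>

lemma takeuchi_symmetric_group_image:
  assumes "takeuchi_symmetric_group G \<sigma>" and "group G'" and hom: "h \<in> hom G G'"
    and onto: "h ` carrier G = carrier G'"
    and s: "\<And>a b. \<lbrakk>a \<in> carrier G; b \<in> carrier G\<rbrakk> \<Longrightarrow> s (h a, h b) = map_prod h h (\<sigma> (a, b))"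
  shows "takeuchi_symmetric_group G' s"
proof -
  define L where "L a b = fst (\<sigma> (a, b))" for a b
  define R where "R a b = snd (\<sigma> (a, b))" for a b
  interpret G: braided_group G \<sigma> L R
    by (rule takeuchi_symmetric_group.axioms(1)[OF assms(1)]) (simp_all add: L_def R_def)
  have invol_G: "\<sigma> (\<sigma> x) = x" if "x \<in> carrier G \<times> carrier G" for x
    using takeuchi_symmetric_group.involutive[OF assms(1) that] .
  have closed_G [simp]: "L a b \<in> carrier G" "R a b \<in> carrier G"
    if "a \<in> carrier G" "b \<in> carrier G" for a b
    using bij_betwE[OF G.bij_braiding] that unfolding L_def R_def
    by (metis SigmaI mem_Times_iff)+
  interpret G': group G' by fact
  interpret h: group_hom G G' h
    using hom by unfold_locales
  have s': "s (h a, h b) = (h (L a b), h (R a b))" if "a \<in> carrier G" "b \<in> carrier G" for a b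
    using s[OF that] by (simp add: L_def R_def map_prod_def case_prod_beta)
  have ex: "\<exists>x\<in>carrier G. a = h x" if "a \<in> carrier G'" for a
    using that onto by blast
  have invol: "s (s x) = x" if x: "x \<in> carrier G' \<times> carrier G'" for x
  proof -
    obtain a b where "x = (h a, h b)" "a \<in> carrier G" "b \<in> carrier G"
      using x unfolding onto[symmetric] by auto
    moreover have "\<sigma> (L a b, R a b) = (a, b)" if "a \<in> carrier G" "b \<in> carrier G" for a b
      using invol_G[of "(a, b)"] that by (simp add: L_def R_def)
    ultimately show ?thesis
      using s[of "L a b" "R a b"] by (simp add: s')
  qed
  have closed: "s x \<in> carrier G' \<times> carrier G'" if x: "x \<in> carrier G' \<times> carrier G'" for x
  proof -
    obtain a b where "x = (h a, h b)" "a \<in> carrier G" "b \<in> carrier G"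
      using x unfolding onto[symmetric] by auto
    then show ?thesis
      by (simp add: s')
  qed
  have bij: "bij_betw s (carrier G' \<times> carrier G') (carrier G' \<times> carrier G')"
    by (rule bij_betw_byWitness[where f' = s]) (use invol closed in blast)+
  have one: "\<one>\<^bsub>G'\<^esub> = h \<one>\<^bsub>G\<^esub>"
    by simp
  show ?thesis
  proof (unfold_locales, goal_cases)
    case 1
    show ?case by (rule bij)
  next
    case (2 u)
    then show ?case using ex[of u] by (auto simp: s' G.one_lact one simp del: h.hom_one)
  next
    case (3 a)
    then show ?case using ex[of a] by (auto simp: s' G.lact_one one simp del: h.hom_one)
  next
    case (4 a b u)
    then show ?case using ex[of a] ex[of b] ex[of u]
      by (auto simp: s' G.mult_lact simp flip: h.hom_mult)
  next
    case (5 a u v)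
    then show ?case using ex[of a] ex[of v] ex[of u]
      by (auto simp: s' G.lact_mult simp flip: h.hom_mult)
  next
    case (6 a)
    then show ?case using ex[of a] by (auto simp: s' G.ract_one one simp del: h.hom_one)
  next
    case (7 u)
    then show ?case using ex[of u] by (auto simp: s' G.one_ract one simp del: h.hom_one)
  next
    case (8 a u v)
    then show ?case using ex[of a] ex[of v] ex[of u]
      by (auto simp: s' G.ract_mult simp flip: h.hom_mult)
  next
    case (9 a b u)
    then show ?case using ex[of a] ex[of b] ex[of u]
      by (auto simp: s' G.mult_ract simp flip: h.hom_mult)
  next
    case (10 a u)
    then show ?case using ex[of a] ex[of u]
      by (auto simp: s' G.compatible[symmetric] simp flip: h.hom_mult)
  next
    case (11 x)
    then show ?case by (rule invol)
  qed
qed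

section \<open>Stability of the socle and the group structure on the retraction\<close>

context takeuchi_symmetric_group
begin

text \<open>As s fixes \<open>inv y\<close>, compatibility for the pair of s and
  \<open>inv y\<close> moves s past \<open>inv y\<close> at the cost of
  \<open>ract s (inv y)\<close>, which \<open>ract_eq\<close> identifies with
  \<open>lact y s\<close>. Normality of the socle thus yields its stability under the
  action.\<close>

lemma lact_socle_eq_conj:
  assumes y: "y \<in> carrier G" and s: "s \<in> socle"
  shows "lact y s = y \<otimes> s \<otimes> inv y"
proof -
  have sG: "s \<in> carrier G" and fix_inv: "lact s (inv y) = inv y"
    using s y by (auto simp: pointwise_stabilizer_def)
  have "s \<otimes> inv y = inv y \<otimes> ract s (inv y)"
    using compatible[OF sG, of "inv y"] y fix_inv by simp
  also have "ract s (inv y) = lact y s"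
    using ract_eq[OF sG, of "inv y"] y fix_inv by simp
  finally have "y \<otimes> (s \<otimes> inv y) = y \<otimes> (inv y \<otimes> lact y s)"
    by simp
  then show ?thesis
    using y sG by (simp add: m_assoc[symmetric])
qed

lemma socle_normal: "socle \<lhd> G"
proof (rule normal_invI)
  show "subgroup socle G"
    by (rule subgroup_pointwise_stabilizer) simp
  fix x s assume x: "x \<in> carrier G" and s: "s \<in> socle"
  then have "s \<in> carrier G" "\<And>z. z \<in> carrier G \<Longrightarrow> lact s z = z"
    by (auto simp: pointwise_stabilizer_def)
  with x show "x \<otimes> s \<otimes> inv x \<in> socle"
    by (simp add: pointwise_stabilizer_def mult_lact)
qed

lemma lact_socle: "\<lbrakk>y \<in> carrier G; s \<in> socle\<rbrakk> \<Longrightarrow> lact y s \<in> socle"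
  using lact_socle_eq_conj normal.inv_op_closed2[OF socle_normal] by simp

abbreviation R where "R \<equiv> retract_rel (carrier G) \<sigma>"

lemma retract_rel_iff:
  "(a, b) \<in> R \<longleftrightarrow> a \<in> carrier G \<and> b \<in> carrier G \<and> (\<forall>z\<in>carrier G. lact a z = lact b z)"
  by (simp add: retract_rel_def lact_def)

lemma equiv_retract_rel: "equiv (carrier G) R"
  by (auto simp: equiv_def refl_on_def sym_def trans_def retract_rel_def)

text \<open>The first form suits the expansion of \<open>lact\<close> over a product, the second the
  hypothesis of \<open>weak_group_morphismsI\<close>.\<close>

lemma retract_rel_iff_socle:
  assumes "a \<in> carrier G" "b \<in> carrier G"
  shows "(a, b) \<in> R \<longleftrightarrow> inv a \<otimes> b \<in> socle" and "(a, b) \<in> R \<longleftrightarrow> a \<otimes> inv b \<in> socle"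
proof -
  have "(\<forall>z\<in>carrier G. lact a z = lact b z) \<longleftrightarrow> (\<forall>z\<in>carrier G. lact (inv a) (lact b z) = z)"
    using assms by (metis lact_inv_lact lact_lact_inv lact_closed)
  then show "(a, b) \<in> R \<longleftrightarrow> inv a \<otimes> b \<in> socle"
    using assms by (simp add: retract_rel_iff pointwise_stabilizer_def mult_lact)
  have "(\<forall>z\<in>carrier G. lact a z = lact b z) \<longleftrightarrow> (\<forall>z\<in>carrier G. lact a (lact (inv b) z) = z)"
    using assms by (metis lact_inv_lact lact_lact_inv lact_closed inv_closed)
  then show "(a, b) \<in> R \<longleftrightarrow> a \<otimes> inv b \<in> socle"
    using assms by (simp add: retract_rel_iff pointwise_stabilizer_def mult_lact)
qed

text \<open>Write b' as b times a socle element. Expanding \<open>lact a b'\<close> leaves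
  \<open>lact a b\<close> times the image of that element under \<open>lact (ract a b)\<close>,
  again in the socle.\<close>

lemma retract_rel_lact_right:
  assumes a: "a \<in> carrier G" and "(b, b') \<in> R"
  shows "(lact a b, lact a b') \<in> R"
proof -
  have b: "b \<in> carrier G" "b' \<in> carrier G"
    using assms(2) by (auto simp: retract_rel_iff)
  have s: "inv b \<otimes> b' \<in> socle"
    using assms(2) retract_rel_iff_socle(1) b by blast
  have "b' = b \<otimes> (inv b \<otimes> b')"
    using b by (simp add: m_assoc[symmetric])
  then have "lact a b' = lact a b \<otimes> lact (ract a b) (inv b \<otimes> b')"
    using lact_mult[OF a b(1), of "inv b \<otimes> b'"] b by simp
  then have "inv (lact a b) \<otimes> lact a b' = lact (ract a b) (inv b \<otimes> b')"
    using a b by (simp add: m_assoc[symmetric])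
  then show ?thesis
    using a b lact_socle[OF _ s] by (simp add: retract_rel_iff_socle(1))
qed

lemma retract_rel_lact:
  assumes "(a, a') \<in> R" "(b, b') \<in> R"
  shows "(lact a b, lact a' b') \<in> R"
  using retract_rel_lact_right[OF _ assms(2), of a] assms by (auto simp: retract_rel_iff)

lemma retract_rel_inv:
  assumes "(a, b) \<in> R"
  shows "(inv a, inv b) \<in> R"
  using assms unfolding retract_rel_iff by (metis lact_inv_lact lact_lact_inv lact_closed inv_closed)

lemma retract_rel_ract:
  assumes "(a, a') \<in> R" "(b, b') \<in> R"
  shows "(ract a b, ract a' b') \<in> R"
  using retract_rel_lact[OF retract_rel_inv[OF retract_rel_lact[OF assms]] assms(1)] assms
  by (auto simp: ract_eq retract_rel_iff)

lemma retract_map_class: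
  assumes "a \<in> carrier G" "b \<in> carrier G"
  shows "retract_map (carrier G) \<sigma> (R `` {a}, R `` {b}) = (R `` {lact a b}, R `` {ract a b})"
proof -
  have "R `` {fst (\<sigma> (x, y))} = R `` {lact a b}" "R `` {snd (\<sigma> (x, y))} = R `` {ract a b}"
    if "x \<in> R `` {a}" "y \<in> R `` {b}" for x y
    using that equiv_class_eq[OF equiv_retract_rel] retract_rel_lact[of a x b y]
      retract_rel_ract[of a x b y]
    by (auto simp: lact_def ract_def)
  moreover have "a \<in> R `` {a}" "b \<in> R `` {b}"
    using assms by (auto simp: retract_rel_iff)
  ultimately show ?thesis
    unfolding retract_map_def by auto
qed

text \<open>The copy Y is a bare set with a map. Its group structure is pushed forward from G along
  \<open>h\<close>, the class map followed by \<open>f\<close>, whose fibres are the cosets of the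
  socle.\<close>

lemma ex_retraction_group:
  "\<exists>(G' :: 'a monoid) s. takeuchi_symmetric_group G' s \<and> order G' * card socle = order G \<and>
    solution_iso (retract_carrier (carrier G) \<sigma>) (retract_map (carrier G) \<sigma>) (carrier G') s"
proof -
  obtain Y s where iso: "solution_iso (retract_carrier (carrier G) \<sigma>)
      (retract_map (carrier G) \<sigma>) (Y :: 'a set) s"
    using retraction_copy[of "carrier G" \<sigma>] by blast
  obtain f where f: "bij_betw f (retract_carrier (carrier G) \<sigma>) Y"
    and fs: "\<And>A B. \<lbrakk>A \<in> retract_carrier (carrier G) \<sigma>; B \<in> retract_carrier (carrier G) \<sigma>\<rbrakk>
      \<Longrightarrow> s (f A, f B) = map_prod f f (retract_map (carrier G) \<sigma> (A, B))"
    using iso unfolding solution_iso_def by blast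
  define h where "h a = f (R `` {a})" for a
  have cls: "R `` {a} \<in> retract_carrier (carrier G) \<sigma>" if "a \<in> carrier G" for a
    using that unfolding retract_carrier_def by (rule quotientI)
  have h_eq: "h a = h b \<longleftrightarrow> a \<otimes> inv b \<in> socle" if "a \<in> carrier G" "b \<in> carrier G" for a b
  proof -
    have "h a = h b \<longleftrightarrow> R `` {a} = R `` {b}"
      unfolding h_def using f cls that by (auto simp: bij_betw_def dest: inj_onD)
    also have "\<dots> \<longleftrightarrow> (a, b) \<in> R"
      using eq_equiv_class_iff[OF equiv_retract_rel that] .
    finally show ?thesis
      using retract_rel_iff_socle(2)[OF that] by simp
  qed
  have wgm: "weak_group_morphism h socle G"
    using socle_normal h_eq by (rule weak_group_morphismsI)
  let ?G' = "image_group h G"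
  have carrier: "carrier ?G' = Y"
  proof -
    have "h ` carrier G = f ` retract_carrier (carrier G) \<sigma>"
      by (auto simp: h_def retract_carrier_def quotient_def)
    then show ?thesis
      using f by (simp add: image_group_carrier bij_betw_def)
  qed
  have "takeuchi_symmetric_group ?G' s"
  proof (rule takeuchi_symmetric_group_image[of G \<sigma> _ h])
    show "takeuchi_symmetric_group G \<sigma>"
      by (rule takeuchi_symmetric_group_axioms[unfolded lact_def ract_def])
    show "group ?G'"
      by (rule image_group_is_group[OF wgm])
    show "h \<in> hom G ?G'"
      by (rule weak_group_morphism_is_hom[OF wgm])
    show "h ` carrier G = carrier ?G'"
      by (simp add: image_group_carrier)
    show "s (h a, h b) = map_prod h h (\<sigma> (a, b))" if "a \<in> carrier G" "b \<in> carrier G" for a b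
      using fs[OF cls cls, OF that] retract_map_class[OF that]
      by (simp add: h_def lact_def ract_def map_prod_def case_prod_beta)
  qed
  moreover have "order ?G' * card socle = order G"
  proof -
    have "order (G Mod socle) = order ?G'"
      using weak_group_morphism_is_iso[OF wgm] iso_same_card unfolding order_def is_iso_def by blast
    then show ?thesis
      using lagrange[of socle] subgroup_pointwise_stabilizer[of "carrier G"]
      by (simp add: FactGroup_def order_def)
  qed
  ultimately show ?thesis
    using iso carrier by blast
qed

end

section \<open>Induction on the order\<close>

lemma (in cube_free_symmetric_group) finite_multipermutation_level_step:
  assumes IH: "\<And>(G' :: 'a monoid) s. \<lbrakk>order G' < order G; takeuchi_symmetric_group G' s;
      finite (carrier G'); cube_free (order G')\<rbrakk> \<Longrightarrow> finite_multipermutation_level (carrier G') s"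
  shows "finite_multipermutation_level (carrier G) \<sigma>"
proof (cases "order G = 1")
  case True
  then show ?thesis
    unfolding finite_multipermutation_level_def order_def by (blast intro: point)
next
  case False
  obtain G' :: "'a monoid" and s where G': "takeuchi_symmetric_group G' s"
      "order G' * card socle = order G"
      "solution_iso (retract_carrier (carrier G) \<sigma>) (retract_map (carrier G) \<sigma>) (carrier G') s"
    using ex_retraction_group by blast
  have "order G > 0"
    using cube_free by (simp add: cube_free_def)
  then have pos: "order G' > 0" "card socle > 0"
    using G'(2) by (metis mult_is_0 gr0I)+
  moreover have "card socle \<noteq> 1"
    using socle_nontrivial[OF False] subgroup.one_closed[OF subgroup_pointwise_stabilizer[of "carrier G"]]
    by (metis card_1_singletonE singletonD order_refl)
  ultimately have "order G' < order G"
    using G'(2) n_less_m_mult_n[of "order G'" "card socle"] by (simp add: mult.commute)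
  moreover have "finite (carrier G')"
    using pos(1) unfolding order_def by (rule card_ge_0_finite)
  moreover have "cube_free (order G')"
    using cube_free pos(1) unfolding cube_free_def G'(2)[symmetric] by (auto intro: dvd_mult2)
  ultimately have "finite_multipermutation_level (carrier G') s"
    using IH G'(1) by blast
  then show ?thesis
    unfolding finite_multipermutation_level_def using retract[OF G'(3)] by blast
qed

text \<open>The group on the retraction is always a plain \<open>'a monoid\<close>, so the induction
  runs over that type and not over arbitrary record extensions.\<close>

lemma finite_multipermutation_level_monoid:
  fixes G :: "'a monoid" (structure)
  assumes "takeuchi_symmetric_group G \<sigma>" and "finite (carrier G)" and "cube_free (order G)"
  shows "finite_multipermutation_level (carrier G) \<sigma>"
  using assms
proof (induction "order G" arbitrary: G \<sigma> rule: less_induct)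
  case less
  then have "cube_free_symmetric_group G \<sigma>"
    by (simp add: cube_free_symmetric_group_def cube_free_symmetric_group_axioms_def)
  then show ?case
    using less.hyps by (rule cube_free_symmetric_group.finite_multipermutation_level_step)
qed

theorem corollary10:
  fixes G (structure) and \<sigma> :: "'a \<times> 'a \<Rightarrow> 'a \<times> 'a"
  assumes "takeuchi_symmetric_group G \<sigma>"
    and "finite (carrier G)" and "cube_free (order G)"
  shows "finite_multipermutation_level (carrier G) \<sigma>"
proof -
  \<comment> \<open>G may be a record extension here: one retraction step leads to plain monoids,
    where the preceding lemma serves as induction hypothesis.\<close>
  have "cube_free_symmetric_group G \<sigma>"
    using assms by (simp add: cube_free_symmetric_group_def cube_free_symmetric_group_axioms_def)
  then show ?thesis
    using finite_multipermutation_level_monoid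
    by (rule cube_free_symmetric_group.finite_multipermutation_level_step)
qed

end
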